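(* For every square regular $0,1$ matrix $M$, there exists a simple regular graph $G$ satisfying \[\mathrm{bp}(G) \leq 33 \cdot \mathrm{rank}_{\mathrm{bin}}(M)^2 \quad\text{and}\quad \chi(G) \geq \mathrm{rank}_{\mathbb{B}}(\overline{M})^{1/3}.\]
   Context: A $0,1$ matrix is regular if there is an integer $d$ such that every row and every column has precisely $d$ ones. $\overline{M}$ is the complement of $M$ (zeros and ones exchanged). The binary rank $\mathrm{rank}_{\mathrm{bin}}(M)$ is the smallest number of combinatorial rectangles $P\times Q$ ($P$ a set of rows, $Q$ a set of columns) consisting only of ones of $M$ that partition the ones of $M$. The Boolean rank $\mathrm{rank}_{\mathbb{B}}(M)$ is the smallest number of combinatorial rectangles consisting only of ones of $M$ that cover the ones of $M$ (overlaps allowed). Graphs are finite and undirected; simple means without loops and parallel edges; regular means that all vertices have the same degree. $\chi(G)$ is the chromatic number, and $\mathrm{bp}(G)$ is the smallest number of edge-disjoint bicliques (complete bipartite subgraphs of $G$, not necessarily induced) that partition the edge set of $G$. *)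

theory Defs
  imports Complex_Main "HOL-Library.Disjoint_Sets" "Jordan_Normal_Form.Matrix"
    "Graph_Theory.Pair_Digraph"
begin

section \<open>Matrices with entries 0 and 1\<close>

definition zero_one_mat :: "int mat \<Rightarrow> bool" where
  "zero_one_mat M \<longleftrightarrow> elements_mat M \<subseteq> {0, 1}"

definition ones :: "int mat \<Rightarrow> (nat \<times> nat) set" where
  "ones M = {(i, j). i < dim_row M \<and> j < dim_col M \<and> M $$ (i, j) = 1}"

definition regular_mat :: "int mat \<Rightarrow> bool" where
  "regular_mat M \<longleftrightarrow> (\<exists>d.
     (\<forall>i < dim_row M. card {j. (i, j) \<in> ones M} = d) \<and>
     (\<forall>j < dim_col M. card {i. (i, j) \<in> ones M} = d))"

definition complement_mat :: "int mat \<Rightarrow> int mat" where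
  "complement_mat M = map_mat (\<lambda>x. 1 - x) M"

definition ones_rectangle :: "int mat \<Rightarrow> (nat \<times> nat) set \<Rightarrow> bool" where
  "ones_rectangle M R \<longleftrightarrow> (\<exists>P Q. R = P \<times> Q) \<and> R \<subseteq> ones M"

definition rank_bin :: "int mat \<Rightarrow> nat" where
  "rank_bin M = (LEAST k. \<exists>\<R>. finite \<R> \<and> card \<R> = k \<and>
     (\<forall>R\<in>\<R>. ones_rectangle M R) \<and> partition_on (ones M) \<R>)"

definition rank_bool :: "int mat \<Rightarrow> nat" where
  "rank_bool M = (LEAST k. \<exists>\<R>. finite \<R> \<and> card \<R> = k \<and>
     (\<forall>R\<in>\<R>. ones_rectangle M R) \<and> \<Union>\<R> = ones M)"

section \<open>Graphs\<close>

text \<open>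
  A finite simple undirected graph is a \<^locale>\<open>pair_graph\<close>, i.e. a finite symmetric
  loop-free set of vertex pairs: an edge between \<open>u\<close> and \<open>v\<close> is the two arcs \<open>(u, v)\<close> and
  \<open>(v, u)\<close>. The degree of a vertex is therefore its out-degree.
\<close>

definition regular_graph :: "'a pair_pre_digraph \<Rightarrow> bool" where
  "regular_graph G \<longleftrightarrow> (\<exists>d. \<forall>v \<in> pverts G. out_degree (with_proj G) v = d)"

definition proper_coloring :: "'a pair_pre_digraph \<Rightarrow> nat \<Rightarrow> ('a \<Rightarrow> nat) \<Rightarrow> bool" where
  "proper_coloring G k c \<longleftrightarrow>
     (\<forall>v \<in> pverts G. c v < k) \<and> (\<forall>(u, v) \<in> parcs G. c u \<noteq> c v)"

definition chromatic_number :: "'a pair_pre_digraph \<Rightarrow> nat" where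
  "chromatic_number G = (LEAST k. \<exists>c. proper_coloring G k c)"

text \<open>
  A biclique is represented by its (symmetric) arc set. For symmetric arc sets, disjointness
  as sets of arcs is edge-disjointness. Empty sides are permitted here, but a biclique with
  an empty side has no arcs and cannot be a part of a \<^const>\<open>partition_on\<close>.
\<close>

definition biclique :: "'a pair_pre_digraph \<Rightarrow> ('a \<times> 'a) set \<Rightarrow> bool" where
  "biclique G F \<longleftrightarrow> (\<exists>A B. A \<subseteq> pverts G \<and> B \<subseteq> pverts G \<and> A \<inter> B = {} \<and>
     F = A \<times> B \<union> B \<times> A) \<and> F \<subseteq> parcs G"

definition bp :: "'a pair_pre_digraph \<Rightarrow> nat" where
  "bp G = (LEAST k. \<exists>\<F>. finite \<F> \<and> card \<F> = k \<and>
     (\<forall>F\<in>\<F>. biclique G F) \<and> partition_on (parcs G) \<F>)"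

end

theory Submission
  imports Defs "HOL-Library.Nat_Bijection"
begin

text \<open>
  Write \<open>k\<close> for the binary rank of \<open>M\<close> and fix a partition of its ones into \<open>k\<close> rectangles.
  Take the zero entries of \<open>M\<close> as vertices. Two zero entries \<open>(x, y)\<close> and \<open>(x', y')\<close> conflict
  if one of the crossing entries \<open>(x, y')\<close>, \<open>(x', y)\<close> is a one of \<open>M\<close>, and conflict doubly if
  both are. A set of pairwise non-conflicting zero entries spans a rectangle of zeros, so every
  proper colouring of the conflict graph yields a cover of the zeros by rectangles, with one
  rectangle per colour (\<open>rank_bool_complement_le\<close>).

  Each rectangle \<open>P \<times> Q\<close> of the partition gives the biclique between the vertices with row in
  \<open>P\<close> and the vertices with column in \<open>Q\<close>. These \<open>k\<close> bicliques cover the conflict graph, but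
  a double conflict is covered twice, so two graphs are used instead.

  \<^item> The double conflict graph: a double conflict determines the two rectangles of its crossing
    entries, which partitions its edges into at most \<open>k\<^sup>2\<close> bicliques
    (\<open>double_conflict_graph_bicliques\<close>).
  \<^item> The conflict graph on a set without double conflicts: here the \<open>k\<close> bicliques are
    edge-disjoint (\<open>conflict_graph_bicliques\<close>).

  If all these graphs have a proper colouring with \<open>r\<close> colours, then colouring first by the double
  conflict graph and then inside each colour class by the conflict graph colours the whole
  conflict graph with \<open>r\<^sup>2\<close> colours. Hence one of these graphs has a chromatic number of at
  least the square root of the Boolean rank of the complement, hence at least its cube root.

  It remains to make that graph regular. This is possible for every graph whose edges are
  partitioned into \<open>m\<close> bicliques: it is a subgraph of a regular graph whose edges are
  partitioned into at most \<open>10 * m\<close> bicliques (\<open>regular_supergraph\<close>). New vertices can be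
  added in large groups of identical neighbourhood, so that all missing degrees can be supplied by
  a linear number of bicliques; and the chromatic number of a supergraph is no smaller.
\<close>

section \<open>Graphs, colourings and biclique partitions\<close>

lemma pair_graphI:
  assumes "finite V" and "E \<subseteq> V \<times> V" and "sym E" and "\<And>v. (v, v) \<notin> E"
  shows "pair_graph \<lparr>pverts = V, parcs = E\<rparr>"
proof -
  have "finite E"
    using assms(1,2) finite_subset by blast
  then show ?thesis
    using assms by unfold_locales (auto simp: symmetric_def)
qed

lemma bicliqueI:
  assumes "A \<inter> B = {}" and "F = A \<times> B \<union> B \<times> A"
    and "A \<subseteq> pverts G" and "B \<subseteq> pverts G" and "F \<subseteq> parcs G"
  shows "biclique G F"
  using assms unfolding biclique_def by blast

lemma bp_le_card:
  assumes "finite \<F>" and "\<And>F. F \<in> \<F> \<Longrightarrow> biclique G F" and "partition_on (parcs G) \<F>"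
  shows "bp G \<le> card \<F>"
  unfolding bp_def by (rule Least_le) (use assms in blast)

lemma proper_coloring_chromatic_number:
  assumes "pair_graph G"
  shows "\<exists>c. proper_coloring G (chromatic_number G) c"
proof -
  interpret pair_graph G by fact
  obtain c :: "'a \<Rightarrow> nat" and n where c: "inj_on c (pverts G)" "c ` pverts G = {i. i < n}"
    using finite_imp_inj_to_nat_seg[OF pair_finite_verts] by metis
  have "c u \<noteq> c v" if "(u, v) \<in> parcs G" for u v
    using that c(1) in_arcsD1 in_arcsD2 pair_no_loops by (fastforce dest: inj_onD)
  then have "proper_coloring G n c"
    using c(2) by (auto simp: proper_coloring_def)
  then show ?thesis
    unfolding chromatic_number_def
    by (intro LeastI_ex[of "\<lambda>k. \<exists>c. proper_coloring G k c"]) blast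
qed

lemma proper_coloring_subgraph:
  assumes "proper_coloring G k c" and "pverts H \<subseteq> pverts G" and "parcs H \<subseteq> parcs G"
  shows "proper_coloring H k c"
  using assms by (auto simp: proper_coloring_def)

section \<open>Degrees in edge-disjoint unions of bicliques\<close>

text \<open>
  Degrees are computed from a list of bicliques, each given by its two sides. Lists keep the order
  in which bicliques with new vertices are added, and bicliques with an empty side are harmless
  list entries; they are discarded only when the list is turned into a partition of the edges.
\<close>

definition biclique_arcs :: "'a set \<times> 'a set \<Rightarrow> ('a \<times> 'a) set" where
  "biclique_arcs p = fst p \<times> snd p \<union> snd p \<times> fst p"

definition union_arcs :: "('a set \<times> 'a set) list \<Rightarrow> ('a \<times> 'a) set" where
  "union_arcs ps = (\<Union>p\<in>set ps. biclique_arcs p)"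

fun edge_disjoint :: "('a set \<times> 'a set) list \<Rightarrow> bool" where
  "edge_disjoint [] \<longleftrightarrow> True"
| "edge_disjoint (p # ps) \<longleftrightarrow>
     fst p \<inter> snd p = {} \<and> biclique_arcs p \<inter> union_arcs ps = {} \<and> edge_disjoint ps"

fun deg :: "('a set \<times> 'a set) list \<Rightarrow> 'a \<Rightarrow> nat" where
  "deg [] v = 0"
| "deg (p # ps) v =
     (if v \<in> fst p then card (snd p) else 0) + (if v \<in> snd p then card (fst p) else 0) + deg ps v"

lemma union_arcs_simps [simp]:
  "union_arcs [] = {}"
  "union_arcs (p # ps) = biclique_arcs p \<union> union_arcs ps"
  "union_arcs (ps @ qs) = union_arcs ps \<union> union_arcs qs"
  by (auto simp: union_arcs_def)

lemma deg_append [simp]: "deg (ps @ qs) v = deg ps v + deg qs v"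
  by (induction ps) auto

lemma deg_eq_0:
  assumes "\<And>P Q. (P, Q) \<in> set ps \<Longrightarrow> v \<notin> P \<and> v \<notin> Q"
  shows "deg ps v = 0"
  using assms
proof (induction ps)
  case (Cons p ps)
  have "v \<notin> fst p" "v \<notin> snd p"
    using Cons.prems[of "fst p" "snd p"] by simp_all
  moreover have "deg ps v = 0"
    by (rule Cons.IH) (use Cons.prems in \<open>meson list.set_intros(2)\<close>)
  ultimately show ?case
    by simp
qed simp

lemma edge_disjoint_append:
  assumes "edge_disjoint ps" and "edge_disjoint qs" and "union_arcs ps \<inter> union_arcs qs = {}"
  shows "edge_disjoint (ps @ qs)"
  using assms by (induction ps) auto

lemma union_arcs_subset:
  assumes "\<And>P Q. (P, Q) \<in> set ps \<Longrightarrow> P \<subseteq> X \<and> Q \<subseteq> X"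
  shows "union_arcs ps \<subseteq> X \<times> X"
  using assms by (fastforce simp: union_arcs_def biclique_arcs_def)

text \<open>
  The way in which all new bicliques below are attached: if one side consists of new vertices,
  edge-disjointness from the earlier bicliques is automatic.
\<close>

lemma edge_disjoint_fresh_side:
  assumes "edge_disjoint ps" and "union_arcs ps \<subseteq> X \<times> X" and "P \<subseteq> X" and "Q \<inter> X = {}"
  shows "edge_disjoint ((P, Q) # ps)"
    and "union_arcs ((P, Q) # ps) \<subseteq> (X \<union> Q) \<times> (X \<union> Q)"
proof -
  have "biclique_arcs (P, Q) \<inter> X \<times> X = {}"
    using assms(4) by (auto simp: biclique_arcs_def)
  then show "edge_disjoint ((P, Q) # ps)"
    using assms by auto
  show "union_arcs ((P, Q) # ps) \<subseteq> (X \<union> Q) \<times> (X \<union> Q)"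
    using assms(2,3) by (auto simp: biclique_arcs_def)
qed

lemma card_neighbours:
  assumes "edge_disjoint ps" and "\<And>P Q. (P, Q) \<in> set ps \<Longrightarrow> finite P \<and> finite Q"
  shows "finite {w. (v, w) \<in> union_arcs ps} \<and> card {w. (v, w) \<in> union_arcs ps} = deg ps v"
  using assms
proof (induction ps)
  case Nil
  then show ?case by simp
next
  case (Cons p ps)
  let ?N = "{w. (v, w) \<in> union_arcs ps}"
  let ?Np = "{w. (v, w) \<in> biclique_arcs p}"
  have IH: "finite ?N" "card ?N = deg ps v"
    using Cons.IH Cons.prems by auto
  have fin: "finite (fst p)" "finite (snd p)"
    using Cons.prems(2)[of "fst p" "snd p"] by auto
  have Np: "?Np = (if v \<in> fst p then snd p else {}) \<union> (if v \<in> snd p then fst p else {})"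
    by (auto simp: biclique_arcs_def)
  have "card ?Np = (if v \<in> fst p then card (snd p) else 0) + (if v \<in> snd p then card (fst p) else 0)"
    using Cons.prems(1) fin unfolding Np by auto
  moreover have "finite ?Np"
    using fin unfolding Np by auto
  moreover have "?Np \<inter> ?N = {}"
    using Cons.prems(1) by auto
  moreover have "{w. (v, w) \<in> union_arcs (p # ps)} = ?Np \<union> ?N"
    by auto
  ultimately show ?case
    using IH by (simp add: card_Un_disjoint)
qed

lemma partition_on_biclique_arcs:
  assumes "edge_disjoint ps"
  shows "partition_on (union_arcs ps) (biclique_arcs ` set ps - {{}})"
proof (rule partition_onI)
  show "\<Union> (biclique_arcs ` set ps - {{}}) = union_arcs ps"
    by (auto simp: union_arcs_def)
  have *: "disjoint (biclique_arcs ` set ps)"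
    using assms
  proof (induction ps)
    case (Cons p ps)
    then have "disjoint (biclique_arcs ` set ps)"
      and "\<And>q. q \<in> set ps \<Longrightarrow> biclique_arcs p \<inter> biclique_arcs q = {}"
      by (auto simp: union_arcs_def)
    then show ?case
      unfolding list.set image_insert pairwise_insert by (auto simp: disjnt_def)
  qed simp
  show "disjnt p q" if "p \<in> biclique_arcs ` set ps - {{}}" "q \<in> biclique_arcs ` set ps - {{}}" "p \<noteq> q" for p q
    using that * by (auto simp: pairwise_def)
qed auto

lemma graph_of_bicliques:
  assumes "finite W" and "edge_disjoint ps" and "\<And>P Q. (P, Q) \<in> set ps \<Longrightarrow> P \<subseteq> W \<and> Q \<subseteq> W"
    and "\<And>v. v \<in> W \<Longrightarrow> deg ps v = d"
  defines "G \<equiv> \<lparr>pverts = W, parcs = union_arcs ps\<rparr>"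
  shows "pair_graph G" and "regular_graph G" and "bp G \<le> length ps"
proof -
  have disj: "fst p \<inter> snd p = {}" if "p \<in> set ps" for p
    using assms(2) that by (induction ps) auto
  show "pair_graph G"
    unfolding G_def
  proof (rule pair_graphI)
    show "union_arcs ps \<subseteq> W \<times> W"
      using assms(3) by (rule union_arcs_subset)
    show "sym (union_arcs ps)"
      by (auto simp: union_arcs_def biclique_arcs_def sym_def)
    show "(v, v) \<notin> union_arcs ps" for v
      using disj by (auto simp: union_arcs_def biclique_arcs_def)
  qed fact
  have "out_degree (with_proj G) v = d" if "v \<in> W" for v
  proof -
    have "out_arcs (with_proj G) v = Pair v ` {w. (v, w) \<in> union_arcs ps}"
      by (auto simp: out_arcs_def G_def)
    then have "out_degree (with_proj G) v = card {w. (v, w) \<in> union_arcs ps}"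
      by (simp add: out_degree_def card_image inj_on_def)
    then show ?thesis
      using card_neighbours[OF assms(2)] assms(1,3,4) that by (metis finite_subset)
  qed
  then show "regular_graph G"
    by (auto simp: regular_graph_def G_def)
  have "bp G \<le> card (biclique_arcs ` set ps - {{}})"
  proof (rule bp_le_card)
    show "partition_on (parcs G) (biclique_arcs ` set ps - {{}})"
      using partition_on_biclique_arcs[OF assms(2)] by (simp add: G_def)
    fix F assume "F \<in> biclique_arcs ` set ps - {{}}"
    then obtain p where p: "p \<in> set ps" "F = biclique_arcs p"
      by auto
    have "F \<subseteq> parcs G"
      using p by (auto simp: G_def union_arcs_def)
    moreover have "fst p \<subseteq> pverts G" "snd p \<subseteq> pverts G"
      using assms(3)[of "fst p" "snd p"] p(1) by (auto simp: G_def)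
    ultimately show "biclique G F"
      using disj[OF p(1)] p(2) unfolding biclique_arcs_def by (intro bicliqueI)
  qed simp
  also have "\<dots> \<le> card (biclique_arcs ` set ps)"
    by (intro card_mono) auto
  also have "\<dots> \<le> length ps"
    using card_image_le[of "set ps" biclique_arcs] card_length[of ps] by simp
  finally show "bp G \<le> length ps" .
qed

section \<open>Making a graph regular at the cost of few bicliques\<close>

lemma obtain_fresh:
  assumes "infinite (UNIV :: 'a set)" and "finite X"
  obtains Y :: "'a set" where "finite Y" "card Y = n" "Y \<inter> X = {}"
proof -
  have "infinite (UNIV - X)"
    using assms by (rule Diff_infinite_finite[rotated])
  then obtain Y where "finite Y" "card Y = n" "Y \<subseteq> UNIV - X"
    using infinite_arbitrarily_large by metis
  then show thesis
    using that by blast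
qed

text \<open>
  The key to regularity. Given bicliques \<open>(A, B)\<close> on a vertex set \<open>V\<close> with \<open>n\<close> vertices, the
  contribution of each biclique to the degrees is made the same, namely \<open>n\<close>, at every vertex of
  \<open>V\<close>. With \<open>C\<close> the rest of \<open>V\<close>, take new sets \<open>DA\<close>, \<open>DB\<close>, \<open>DC\<close> whose
  sizes fill \<open>A\<close>, \<open>B\<close>, \<open>C\<close> up to \<open>n\<close> vertices, and a new set \<open>D\<close> of size
  \<open>n\<close>. Enlarging the given biclique to one between \<open>A \<union> DA\<close> and \<open>B \<union> DB\<close> and joining
  \<open>C \<union> DC\<close> to \<open>D\<close> gives two bicliques with all sides of size \<open>n\<close>. The enlargement is
  expressed by two additional bicliques, so the given one stays as it is. The number of new
  vertices is \<open>(n - |A|) + (n - |B|) + (n - |C|) + n = 3 * n\<close>, whatever \<open>A\<close> and \<open>B\<close>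
  are, and each of them has degree \<open>n\<close>.

  The edges inside \<open>V\<close> are avoided, so that the given bicliques can be kept beside the new ones.
\<close>

lemma degree_completion:
  fixes V :: "'a set"
  assumes inf: "infinite (UNIV :: 'a set)" and V: "finite V"
    and "\<forall>(A, B)\<in>set ps. A \<subseteq> V \<and> B \<subseteq> V \<and> A \<inter> B = {}"
  shows "\<exists>es U. length es = 3 * length ps \<and> finite U \<and> U \<inter> V = {} \<and>
    card U = 3 * card V * length ps \<and>
    (\<forall>(P, Q)\<in>set es. P \<subseteq> V \<union> U \<and> Q \<subseteq> V \<union> U) \<and>
    edge_disjoint es \<and> union_arcs es \<inter> V \<times> V = {} \<and>
    (\<forall>v\<in>V. deg (ps @ es) v = card V * length ps) \<and> (\<forall>u\<in>U. deg es u = card V)"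
  using assms(3)
proof (induction ps)
  case Nil
  show ?case
    by (intro exI[of _ "[]"] exI[of _ "{}"]) auto
next
  case (Cons p ps)
  obtain A B where p: "p = (A, B)" by fastforce
  have "\<forall>(A, B)\<in>set ps. A \<subseteq> V \<and> B \<subseteq> V \<and> A \<inter> B = {}"
    using Cons.prems by simp
  from Cons.IH[OF this] obtain es U where
    len: "length es = 3 * length ps" and U: "finite U" "U \<inter> V = {}" "card U = 3 * card V * length ps"
    and sub: "\<forall>(P, Q)\<in>set es. P \<subseteq> V \<union> U \<and> Q \<subseteq> V \<union> U"
    and ed: "edge_disjoint es" "union_arcs es \<inter> V \<times> V = {}"
    and V_deg: "\<forall>v\<in>V. deg (ps @ es) v = card V * length ps"
    and U_deg: "\<forall>u\<in>U. deg es u = card V"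
    by (elim exE conjE) (rule that; assumption)
  note degV = bspec[OF V_deg] and degU = bspec[OF U_deg]
  have AB: "A \<subseteq> V" "B \<subseteq> V" "A \<inter> B = {}"
    using Cons.prems p by auto
  define C where "C = V - A - B"
  let ?n = "card V"
  have fin: "finite A" "finite B" "finite C"
    using AB V finite_subset by (auto simp: C_def)
  have le: "card A \<le> ?n" "card B \<le> ?n" "card C \<le> ?n"
    using AB V by (auto simp: C_def intro: card_mono)
  have V_eq: "V = A \<union> B \<union> C"
    using AB by (auto simp: C_def)
  have n: "?n = card A + card B + card C"
  proof -
    have "(A \<union> B) \<inter> C = {}"
      by (auto simp: C_def)
    then have "card (A \<union> B \<union> C) = card A + card B + card C"
      using AB(3) fin by (simp add: card_Un_disjoint)
    then show ?thesis
      by (simp flip: V_eq)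
  qed
  obtain DA where DA: "finite DA" "card DA = ?n - card A" "DA \<inter> (V \<union> U) = {}"
    using obtain_fresh[OF inf] V U(1) by (metis finite_UnI)
  obtain DB where DB: "finite DB" "card DB = ?n - card B" "DB \<inter> (V \<union> U \<union> DA) = {}"
    using obtain_fresh[OF inf] V U(1) DA(1) by (metis finite_UnI)
  obtain DC where DC: "finite DC" "card DC = ?n - card C" "DC \<inter> (V \<union> U \<union> DA \<union> DB) = {}"
    using obtain_fresh[OF inf] V U(1) DA(1) DB(1) by (metis finite_UnI)
  obtain D where D: "finite D" "card D = ?n" "D \<inter> (V \<union> U \<union> DA \<union> DB \<union> DC) = {}"
    using obtain_fresh[OF inf] V U(1) DA(1) DB(1) DC(1) by (metis finite_UnI)
  have fresh: "DA \<inter> V = {}" "DA \<inter> U = {}" "DB \<inter> V = {}" "DB \<inter> U = {}" "DB \<inter> DA = {}"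
    "DC \<inter> V = {}" "DC \<inter> U = {}" "DC \<inter> DA = {}" "DC \<inter> DB = {}"
    "D \<inter> V = {}" "D \<inter> U = {}" "D \<inter> DA = {}" "D \<inter> DB = {}" "D \<inter> DC = {}"
    using DA(3) DB(3) DC(3) D(3) by auto
  \<comment> \<open>Read from right to left, the second side of each new biclique is new.\<close>
  define es' where "es' = (B \<union> DB, DA) # (A, DB) # (C \<union> DC, D) # es"
  define U' where "U' = U \<union> DA \<union> DB \<union> DC \<union> D"
  have cards: "card (B \<union> DB) = ?n" "card (A \<union> DA) = ?n" "card (C \<union> DC) = ?n"
    using fin DA DB DC AB le by (subst card_Un_disjoint; auto simp: C_def)+
  have es_sub: "union_arcs es \<subseteq> (V \<union> U) \<times> (V \<union> U)"
    by (rule union_arcs_subset) (use sub in blast)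
  have deg_new: "deg es u = 0" if "u \<notin> V \<union> U" for u
    using that sub by (intro deg_eq_0) blast
  have "length es' = 3 * length (p # ps)"
    by (simp add: es'_def len)
  moreover have "finite U'" "U' \<inter> V = {}"
    using U DA DB DC D by (auto simp: U'_def)
  moreover have "card U' = 3 * ?n * length (p # ps)"
  proof -
    have "U \<inter> DA = {}" "(U \<union> DA) \<inter> DB = {}" "(U \<union> DA \<union> DB) \<inter> DC = {}"
      "(U \<union> DA \<union> DB \<union> DC) \<inter> D = {}"
      using fresh by auto
    then have "card U' = card U + card DA + card DB + card DC + card D"
      unfolding U'_def using U(1) DA(1) DB(1) DC(1) D(1) by (simp add: card_Un_disjoint)
    then show ?thesis
      using U(3) DA(2) DB(2) DC(2) D(2) n by (simp add: algebra_simps)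
  qed
  moreover have "\<forall>(P, Q)\<in>set es'. P \<subseteq> V \<union> U' \<and> Q \<subseteq> V \<union> U'"
  proof -
    have "\<forall>(P, Q)\<in>set es. P \<subseteq> V \<union> U' \<and> Q \<subseteq> V \<union> U'"
      using sub unfolding U'_def by blast
    moreover have "A \<subseteq> V \<union> U'" "B \<union> DB \<subseteq> V \<union> U'" "C \<union> DC \<subseteq> V \<union> U'"
      "DA \<subseteq> V \<union> U'" "DB \<subseteq> V \<union> U'" "D \<subseteq> V \<union> U'"
      using AB by (auto simp: U'_def C_def)
    ultimately show ?thesis
      by (simp add: es'_def)
  qed
  moreover have "edge_disjoint es'"
  proof -
    let ?X = "V \<union> U \<union> DC"
    have sub_X: "union_arcs es \<subseteq> ?X \<times> ?X" and "C \<union> DC \<subseteq> ?X" and "D \<inter> ?X = {}"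
      using es_sub fresh by (auto simp: C_def)
    note 1 = edge_disjoint_fresh_side[OF ed(1) this]
    have "A \<subseteq> ?X \<union> D" and "DB \<inter> (?X \<union> D) = {}"
      using AB fresh by auto
    note 2 = edge_disjoint_fresh_side[OF 1 this]
    have "B \<union> DB \<subseteq> ?X \<union> D \<union> DB" and "DA \<inter> (?X \<union> D \<union> DB) = {}"
      using AB fresh by auto
    then show ?thesis
      unfolding es'_def by (rule edge_disjoint_fresh_side(1)[OF 2])
  qed
  moreover have "union_arcs es' \<inter> V \<times> V = {}"
  proof -
    have "biclique_arcs (P, Q) \<inter> V \<times> V = {}" if "Q \<inter> V = {}" for P Q
      using that by (auto simp: biclique_arcs_def)
    then show ?thesis
      using ed(2) fresh by (simp add: es'_def Int_Un_distrib2)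
  qed
  moreover have "\<forall>v\<in>V. deg ((p # ps) @ es') v = ?n * length (p # ps)"
  proof
    fix v assume v: "v \<in> V"
    then have "v \<notin> DA" "v \<notin> DB" "v \<notin> DC" "v \<notin> D"
      using fresh by auto
    then show "deg ((p # ps) @ es') v = ?n * length (p # ps)"
      using degV[OF v] v AB le DA(2) DB(2) D(2) cards
      by (auto simp: es'_def p C_def)
  qed
  moreover have "\<forall>u\<in>U'. deg es' u = ?n"
  proof
    fix u assume "u \<in> U'"
    then consider "u \<in> U" | "u \<in> DA" | "u \<in> DB" | "u \<in> DC" | "u \<in> D"
      unfolding U'_def by blast
    then show "deg es' u = ?n"
    proof cases
      case 1
      then have "u \<notin> A" "u \<notin> B" "u \<notin> C" "u \<notin> DA" "u \<notin> DB" "u \<notin> DC" "u \<notin> D"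
        using fresh U(2) V_eq by auto
      then show ?thesis using degU[OF 1] by (simp add: es'_def)
    next
      case 2
      then have "u \<notin> A" "u \<notin> B" "u \<notin> C" "u \<notin> DB" "u \<notin> DC" "u \<notin> D" "u \<notin> V \<union> U"
        using fresh V_eq by auto
      then show ?thesis using 2 deg_new cards by (simp add: es'_def)
    next
      case 3
      then have "u \<notin> A" "u \<notin> B" "u \<notin> C" "u \<notin> DA" "u \<notin> DC" "u \<notin> D" "u \<notin> V \<union> U"
        using fresh V_eq by auto
      then show ?thesis using 3 deg_new DA(2) le by (simp add: es'_def)
    next
      case 4
      then have "u \<notin> A" "u \<notin> B" "u \<notin> C" "u \<notin> DA" "u \<notin> DB" "u \<notin> D" "u \<notin> V \<union> U"
        using fresh V_eq by auto
      then show ?thesis using 4 deg_new D(2) by (simp add: es'_def)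
    next
      case 5
      then have "u \<notin> A" "u \<notin> B" "u \<notin> C" "u \<notin> DA" "u \<notin> DB" "u \<notin> DC" "u \<notin> V \<union> U"
        using fresh V_eq by auto
      then show ?thesis using 5 deg_new cards by (simp add: es'_def)
    qed
  qed
  ultimately show ?case
    by blast
qed

lemma split_in_three:
  assumes "card U = 3 * s" and "finite U"
  obtains S1 S2 S3 where "U = S1 \<union> S2 \<union> S3" "card S1 = s" "card S2 = s" "card S3 = s"
    "S1 \<inter> S2 = {}" "S1 \<inter> S3 = {}" "S2 \<inter> S3 = {}"
proof -
  obtain S1 where S1: "S1 \<subseteq> U" "card S1 = s" "finite S1"
    using obtain_subset_with_card_n[of s U] assms(1) by auto
  have "card (U - S1) = 2 * s"
    using S1 assms by (simp add: card_Diff_subset)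
  then obtain S2 where S2: "S2 \<subseteq> U - S1" "card S2 = s" "finite S2"
    using obtain_subset_with_card_n[of s "U - S1"] by auto
  have "card (U - S1 - S2) = s"
    using S2 \<open>card (U - S1) = 2 * s\<close> by (simp add: card_Diff_subset)
  with S1 S2 that[of S1 S2 "U - S1 - S2"] show thesis
    by blast
qed

text \<open>
  After \<open>degree_completion\<close> only two degrees occur, one on the old and one on the new vertices.
  It is applied to the \<open>m\<close> bicliques of \<open>\<Gamma>\<close> and one additional empty biclique. Then the old
  vertices have degree \<open>(m + 1) * n\<close>, and the \<open>3 * (m + 1) * n\<close> new vertices have degree
  \<open>n\<close>, so they lack \<open>m * n\<close>. Split them into three sets of \<open>(m + 1) * n\<close> vertices and join
  each of these to a further set of \<open>m * n\<close> vertices: this supplies exactly the missing degree,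
  and the further vertices get degree \<open>(m + 1) * n\<close> as well. The empty biclique is what makes the
  three sets as large as the common degree.

  Altogether these are \<open>m + 3 * (m + 1) + 3 = 4 * m + 6\<close> bicliques, which is at most
  \<open>10 * m\<close> for positive \<open>m\<close>.
\<close>

theorem regular_supergraph:
  fixes \<Gamma> :: "'a pair_pre_digraph"
  assumes inf: "infinite (UNIV :: 'a set)" and "pair_graph \<Gamma>"
    and "finite \<F>" and bic: "\<And>F. F \<in> \<F> \<Longrightarrow> biclique \<Gamma> F" and part: "partition_on (parcs \<Gamma>) \<F>"
  shows "\<exists>G. pair_graph G \<and> pverts G \<noteq> {} \<and> regular_graph G \<and>
    pverts \<Gamma> \<subseteq> pverts G \<and> parcs \<Gamma> \<subseteq> parcs G \<and> bp G \<le> 10 * card \<F>"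
proof (cases "\<F> = {}")
  case True
  \<comment> \<open>A graph without edges is regular; a vertex is added in case it has none.\<close>
  then have "parcs \<Gamma> = {}"
    using part by (simp add: partition_on_def)
  moreover have "finite (pverts \<Gamma>)"
    using \<open>pair_graph \<Gamma>\<close> by (simp add: pair_fin_digraph.pair_finite_verts pair_graph_def pair_digraph_def)
  ultimately show ?thesis
    using graph_of_bicliques[of "insert undefined (pverts \<Gamma>)" "[]" 0]
    by (intro exI[of _ "\<lparr>pverts = insert undefined (pverts \<Gamma>), parcs = {}\<rparr>"]) auto
next
  case False
  interpret pair_graph \<Gamma> by fact
  let ?V = "pverts \<Gamma>"
  let ?n = "card ?V"
  let ?m = "card \<F>"
  have m: "?m \<ge> 1"
    using False \<open>finite \<F>\<close> by (simp add: Suc_leI card_gt_0_iff)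
  have "\<exists>p. fst p \<subseteq> ?V \<and> snd p \<subseteq> ?V \<and> fst p \<inter> snd p = {} \<and> biclique_arcs p = F" if "F \<in> \<F>" for F
    using bic[OF that] unfolding biclique_def biclique_arcs_def by auto
  then obtain sides where sides: "\<And>F. F \<in> \<F> \<Longrightarrow> fst (sides F) \<subseteq> ?V \<and> snd (sides F) \<subseteq> ?V \<and>
      fst (sides F) \<inter> snd (sides F) = {} \<and> biclique_arcs (sides F) = F"
    by metis
  obtain Fs where Fs: "set Fs = \<F>" "distinct Fs"
    using finite_distinct_list[OF \<open>finite \<F>\<close>] by blast
  define ps where "ps = map sides Fs"
  have len: "length ps = ?m"
    using Fs by (simp add: ps_def flip: distinct_card)
  have ps_sub: "A \<subseteq> ?V \<and> B \<subseteq> ?V \<and> A \<inter> B = {}" if AB: "(A, B) \<in> set ps" for A B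
  proof -
    obtain F where "F \<in> \<F>" "sides F = (A, B)"
      using AB Fs(1) by (auto simp: ps_def)
    then show ?thesis
      using sides[of F] by simp
  qed
  have ps_arcs: "union_arcs ps = parcs \<Gamma>"
    using sides Fs(1) part by (auto simp: ps_def union_arcs_def partition_on_def)
  have "edge_disjoint (map sides Gs)" if "set Gs \<subseteq> \<F>" "distinct Gs" for Gs
    using that
  proof (induction Gs)
    case (Cons F Gs)
    then have "F \<inter> F' = {}" if "F' \<in> set Gs" for F'
      using that part partition_onD2 by (fastforce simp: pairwise_def disjnt_def)
    moreover have "biclique_arcs (sides F') = F'" if "F' \<in> set Gs" for F'
      using that Cons.prems sides by auto
    ultimately have "F \<inter> (\<Union>F'\<in>set Gs. biclique_arcs (sides F')) = {}"
      by auto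
    then show ?case
      using Cons sides by (auto simp: union_arcs_def)
  qed simp
  then have ps_disj: "edge_disjoint ps"
    using Fs by (simp add: ps_def)
  have "\<forall>(A, B)\<in>set (({}, {}) # ps). A \<subseteq> ?V \<and> B \<subseteq> ?V \<and> A \<inter> B = {}"
    using ps_sub by fastforce
  from degree_completion[OF inf pair_finite_verts this]
  obtain es U where
    es_length: "length es = 3 * length (({}, {}) # ps)"
    and U: "finite U" "U \<inter> ?V = {}" and cardU: "card U = 3 * ?n * length (({}, {}) # ps)"
    and es_sub: "\<forall>(P, Q)\<in>set es. P \<subseteq> ?V \<union> U \<and> Q \<subseteq> ?V \<union> U"
    and ed: "edge_disjoint es" "union_arcs es \<inter> ?V \<times> ?V = {}"
    and V_deg: "\<forall>v\<in>?V. deg ((({}, {}) # ps) @ es) v = ?n * length (({}, {}) # ps)"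
    and U_deg: "\<forall>u\<in>U. deg es u = ?n"
    by (elim exE conjE) (rule that; assumption)
  have es_len: "length es = 3 * (?m + 1)" and U_card: "card U = 3 * ((?m + 1) * ?n)"
    using es_length cardU by (simp_all add: len)
  have degV: "deg (ps @ es) v = (?m + 1) * ?n" if "v \<in> ?V" for v
    using bspec[OF V_deg that] by (simp add: len)
  note degU = bspec[OF U_deg]
  obtain S1 S2 S3 where S: "U = S1 \<union> S2 \<union> S3" and
    cardS: "card S1 = (?m + 1) * ?n" "card S2 = (?m + 1) * ?n" "card S3 = (?m + 1) * ?n" and
    disjS: "S1 \<inter> S2 = {}" "S1 \<inter> S3 = {}" "S2 \<inter> S3 = {}"
    using split_in_three[OF U_card U(1)] by metis
  obtain Y1 where Y1: "finite Y1" "card Y1 = ?m * ?n" "Y1 \<inter> (?V \<union> U) = {}"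
    using obtain_fresh[OF inf] pair_finite_verts U(1) by (metis finite_UnI)
  obtain Y2 where Y2: "finite Y2" "card Y2 = ?m * ?n" "Y2 \<inter> (?V \<union> U \<union> Y1) = {}"
    using obtain_fresh[OF inf] pair_finite_verts U(1) Y1(1) by (metis finite_UnI)
  obtain Y3 where Y3: "finite Y3" "card Y3 = ?m * ?n" "Y3 \<inter> (?V \<union> U \<union> Y1 \<union> Y2) = {}"
    using obtain_fresh[OF inf] pair_finite_verts U(1) Y1(1) Y2(1) by (metis finite_UnI)
  define W where "W = ?V \<union> U \<union> Y1 \<union> Y2 \<union> Y3"
  define qs where "qs = [(S1, Y1), (S2, Y2), (S3, Y3)]"
  have old_sub: "P \<subseteq> ?V \<union> U \<and> Q \<subseteq> ?V \<union> U" if "(P, Q) \<in> set (ps @ es)" for P Q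
    using that ps_sub es_sub by (auto; blast)
  have old: "union_arcs (ps @ es) \<subseteq> (?V \<union> U) \<times> (?V \<union> U)"
    using old_sub by (rule union_arcs_subset)
  have fresh: "Y1 \<inter> ?V = {}" "Y1 \<inter> U = {}" "Y2 \<inter> ?V = {}" "Y2 \<inter> U = {}" "Y2 \<inter> Y1 = {}"
    "Y3 \<inter> ?V = {}" "Y3 \<inter> U = {}" "Y3 \<inter> Y1 = {}" "Y3 \<inter> Y2 = {}"
    using Y1(3) Y2(3) Y3(3) by auto
  have S_sub: "S1 \<subseteq> U" "S2 \<subseteq> U" "S3 \<subseteq> U"
    using S by auto
  have "union_arcs ps \<subseteq> ?V \<times> ?V"
    by (rule union_arcs_subset) (use ps_sub in blast)
  then have "union_arcs ps \<inter> union_arcs es = {}"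
    using ed(2) by auto
  then have old_disj: "edge_disjoint (ps @ es)"
    using ps_disj ed(1) by (intro edge_disjoint_append)
  have W_disj: "edge_disjoint (qs @ ps @ es)"
  proof -
    let ?X = "?V \<union> U"
    have "S3 \<subseteq> ?X" "Y3 \<inter> ?X = {}"
      using S_sub fresh by auto
    note 1 = edge_disjoint_fresh_side[OF old_disj old this]
    have "S2 \<subseteq> ?X \<union> Y3" "Y2 \<inter> (?X \<union> Y3) = {}"
      using S_sub fresh by auto
    note 2 = edge_disjoint_fresh_side[OF 1 this]
    have "S1 \<subseteq> ?X \<union> Y3 \<union> Y2" "Y1 \<inter> (?X \<union> Y3 \<union> Y2) = {}"
      using S_sub fresh by auto
    then have "edge_disjoint ((S1, Y1) # (S2, Y2) # (S3, Y3) # ps @ es)"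
      by (rule edge_disjoint_fresh_side(1)[OF 2])
    then show ?thesis
      by (simp add: qs_def)
  qed
  have W_fin: "finite W"
    using pair_finite_verts U(1) Y1(1) Y2(1) Y3(1) by (simp add: W_def)
  have W_sub: "P \<subseteq> W \<and> Q \<subseteq> W" if "(P, Q) \<in> set (qs @ ps @ es)" for P Q
  proof -
    have "(P, Q) \<in> set qs \<or> (P, Q) \<in> set (ps @ es)"
      using that by auto
    then show ?thesis
      using old_sub[of P Q] S_sub by (auto simp: qs_def W_def)
  qed
  have W_deg: "deg (qs @ ps @ es) v = (?m + 1) * ?n" if "v \<in> W" for v
  proof -
    have ps0: "deg ps v = 0" if "v \<notin> ?V"
      by (rule deg_eq_0) (use that ps_sub in blast)
    have old0: "deg (ps @ es) v = 0" if "v \<notin> ?V \<union> U"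
      by (rule deg_eq_0) (use that old_sub in blast)
    consider "v \<in> ?V" | "v \<in> S1" | "v \<in> S2" | "v \<in> S3" | "v \<in> Y1" | "v \<in> Y2" | "v \<in> Y3"
      using \<open>v \<in> W\<close> S by (auto simp: W_def)
    then show ?thesis
    proof cases
      case 1
      then have "v \<notin> S1" "v \<notin> S2" "v \<notin> S3" "v \<notin> Y1" "v \<notin> Y2" "v \<notin> Y3"
        using fresh U(2) S by auto
      then show ?thesis using degV[OF 1] by (simp add: qs_def)
    next
      case 2
      then have "v \<notin> ?V" "v \<in> U" "v \<notin> S2" "v \<notin> S3" "v \<notin> Y1" "v \<notin> Y2" "v \<notin> Y3"
        using fresh U(2) S disjS by auto
      then show ?thesis using 2 ps0 degU Y1(2) by (simp add: qs_def)
    next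
      case 3
      then have "v \<notin> ?V" "v \<in> U" "v \<notin> S1" "v \<notin> S3" "v \<notin> Y1" "v \<notin> Y2" "v \<notin> Y3"
        using fresh U(2) S disjS by auto
      then show ?thesis using 3 ps0 degU Y2(2) by (simp add: qs_def)
    next
      case 4
      then have "v \<notin> ?V" "v \<in> U" "v \<notin> S1" "v \<notin> S2" "v \<notin> Y1" "v \<notin> Y2" "v \<notin> Y3"
        using fresh U(2) S disjS by auto
      then show ?thesis using 4 ps0 degU Y3(2) by (simp add: qs_def)
    next
      case 5
      then have "v \<notin> ?V \<union> U" "v \<notin> S1" "v \<notin> S2" "v \<notin> S3" "v \<notin> Y2" "v \<notin> Y3"
        using fresh S by auto
      then show ?thesis using 5 old0 cardS by (simp add: qs_def)
    next
      case 6
      then have "v \<notin> ?V \<union> U" "v \<notin> S1" "v \<notin> S2" "v \<notin> S3" "v \<notin> Y1" "v \<notin> Y3"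
        using fresh S by auto
      then show ?thesis using 6 old0 cardS by (simp add: qs_def)
    next
      case 7
      then have "v \<notin> ?V \<union> U" "v \<notin> S1" "v \<notin> S2" "v \<notin> S3" "v \<notin> Y1" "v \<notin> Y2"
        using fresh S by auto
      then show ?thesis using 7 old0 cardS by (simp add: qs_def)
    qed
  qed
  note G = graph_of_bicliques[OF W_fin W_disj W_sub W_deg]
  have "length (qs @ ps @ es) \<le> 10 * ?m"
    using m es_len len by (simp add: qs_def)
  moreover have "?V \<noteq> {}"
  proof
    assume "?V = {}"
    then have "\<F> \<subseteq> {{}}"
      using bic by (auto simp: biclique_def)
    then show False
      using False part by (auto simp: partition_on_def)
  qed
  ultimately show ?thesis
    using G ps_arcs by (intro exI[of _ "\<lparr>pverts = W, parcs = union_arcs (qs @ ps @ es)\<rparr>"])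
      (auto simp: W_def)
qed

section \<open>Zeros, ones and rectangles\<close>

lemma ones_complement_mat:
  assumes "zero_one_mat M"
  shows "ones (complement_mat M) =
    {(i, j). i < dim_row M \<and> j < dim_col M \<and> (i, j) \<notin> ones M}"
proof -
  have "M $$ (i, j) \<in> {0, 1}" if "i < dim_row M" "j < dim_col M" for i j
    using assms that unfolding zero_one_mat_def by (meson carrier_matI elements_matI subsetD)
  then show ?thesis
    by (fastforce simp: ones_def complement_mat_def)
qed

lemma finite_ones: "finite (ones M)"
  by (rule finite_subset[of _ "{..<dim_row M} \<times> {..<dim_col M}"]) (auto simp: ones_def)

lemma rank_bin_partition:
  "\<exists>\<R>. finite \<R> \<and> card \<R> = rank_bin M \<and> (\<forall>R\<in>\<R>. ones_rectangle M R) \<and> partition_on (ones M) \<R>"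
proof -
  let ?\<R> = "(\<lambda>e. {e}) ` ones M"
  have "\<forall>R\<in>?\<R>. ones_rectangle M R"
    unfolding ones_rectangle_def by (auto intro!: exI[of _ "{_}"])
  moreover have "partition_on (ones M) ?\<R>"
    by (intro partition_onI) auto
  ultimately show ?thesis
    unfolding rank_bin_def using finite_ones[of M]
    by (intro LeastI_ex[of "\<lambda>k. \<exists>\<R>. finite \<R> \<and> card \<R> = k \<and>
      (\<forall>R\<in>\<R>. ones_rectangle M R) \<and> partition_on (ones M) \<R>"]) blast
qed

text \<open>
  The entries of one colour are covered by the rectangle of all their rows and all their columns,
  and the condition on crossing entries says that this rectangle contains no ones.
\<close>

lemma rank_bool_complement_le:
  assumes zo: "zero_one_mat M" and "finite K"
    and f: "f ` ones (complement_mat M) \<subseteq> K"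
    and compat: "\<And>x y x' y'. (x, y) \<in> ones (complement_mat M) \<Longrightarrow>
      (x', y') \<in> ones (complement_mat M) \<Longrightarrow> f (x, y) = f (x', y') \<Longrightarrow> (x, y') \<notin> ones M"
  shows "rank_bool (complement_mat M) \<le> card K"
proof -
  let ?Z = "ones (complement_mat M)"
  define R where "R a = fst ` {e \<in> ?Z. f e = a} \<times> snd ` {e \<in> ?Z. f e = a}" for a
  let ?\<R> = "R ` f ` ?Z"
  have sub: "R a \<subseteq> ?Z" for a
  proof
    fix e assume "e \<in> R a"
    then obtain x y x' y' where e: "e = (x, y')" and *: "(x, y) \<in> ?Z" "(x', y') \<in> ?Z" "f (x, y) = f (x', y')"
      by (auto simp: R_def)
    have "(x, y') \<notin> ones M"
      using * by (rule compat)
    then show "e \<in> ?Z"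
      using *(1,2) e by (simp add: ones_complement_mat[OF zo])
  qed
  have "rank_bool (complement_mat M) \<le> card ?\<R>"
    unfolding rank_bool_def
  proof (rule Least_le, intro exI[of _ ?\<R>] conjI ballI refl)
    show "finite ?\<R>"
      by (intro finite_imageI finite_ones)
    show "ones_rectangle (complement_mat M) S" if "S \<in> ?\<R>" for S
      using that sub unfolding ones_rectangle_def by (auto simp: R_def)
    show "\<Union> ?\<R> = ?Z"
    proof
      show "\<Union> ?\<R> \<subseteq> ?Z"
        using sub by blast
      show "?Z \<subseteq> \<Union> ?\<R>"
      proof
        fix e assume "e \<in> ?Z"
        then have "e \<in> R (f e)"
          by (auto simp: R_def mem_Times_iff)
        then show "e \<in> \<Union> ?\<R>"
          using \<open>e \<in> ?Z\<close> by blast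
      qed
    qed
  qed
  also have "\<dots> \<le> card (f ` ?Z)"
    by (intro card_image_le finite_imageI finite_ones)
  also have "\<dots> \<le> card K"
    using f \<open>finite K\<close> by (rule card_mono[rotated])
  finally show ?thesis .
qed

section \<open>Conflicts between zero entries\<close>

text \<open>
  The zero entries are encoded as natural numbers by the pairing function, so that the vertices of
  all graphs, including the vertices added for regularity, come from one infinite type.
\<close>

definition vertex_row :: "nat \<Rightarrow> nat" where
  "vertex_row v = fst (prod_decode v)"

definition vertex_col :: "nat \<Rightarrow> nat" where
  "vertex_col v = snd (prod_decode v)"

lemma vertex_row_encode [simp]: "vertex_row (prod_encode (x, y)) = x"
  and vertex_col_encode [simp]: "vertex_col (prod_encode (x, y)) = y"
  by (simp_all add: vertex_row_def vertex_col_def)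

definition zero_vertices :: "int mat \<Rightarrow> nat set" where
  "zero_vertices M = {v. (vertex_row v, vertex_col v) \<in> ones (complement_mat M)}"

definition double_conflict_graph :: "int mat \<Rightarrow> nat pair_pre_digraph" where
  "double_conflict_graph M = \<lparr>pverts = zero_vertices M, parcs = {(u, v).
     u \<in> zero_vertices M \<and> v \<in> zero_vertices M \<and>
     (vertex_row u, vertex_col v) \<in> ones M \<and> (vertex_row v, vertex_col u) \<in> ones M}\<rparr>"

definition conflict_graph :: "int mat \<Rightarrow> nat set \<Rightarrow> nat pair_pre_digraph" where
  "conflict_graph M S = \<lparr>pverts = S, parcs = {(u, v).
     u \<in> S \<and> v \<in> S \<and> ((vertex_row u, vertex_col v) \<in> ones M \<or> (vertex_row v, vertex_col u) \<in> ones M)}\<rparr>"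

lemma finite_zero_vertices: "finite (zero_vertices M)"
proof -
  have "zero_vertices M = prod_encode ` ones (complement_mat M)"
    by (force simp: zero_vertices_def vertex_row_def vertex_col_def image_iff)
  then show ?thesis
    by (simp add: finite_ones)
qed

text \<open>
  Conflicts are irreflexive because a zero entry crosses itself in a zero.
\<close>

lemma zero_vertices_not_ones:
  assumes "v \<in> zero_vertices M"
  shows "(vertex_row v, vertex_col v) \<notin> ones M"
  using assms by (auto simp: zero_vertices_def ones_def complement_mat_def)

lemma ones_rectangle_iff:
  assumes "ones_rectangle M R"
  shows "(x, y) \<in> R \<longleftrightarrow> x \<in> fst ` R \<and> y \<in> snd ` R"
  using assms by (force simp: ones_rectangle_def)

lemma pair_graph_double_conflict_graph: "pair_graph (double_conflict_graph M)"
  unfolding double_conflict_graph_def using zero_vertices_not_ones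
  by (intro pair_graphI finite_zero_vertices) (auto simp: sym_def)

lemma pair_graph_conflict_graph:
  assumes "S \<subseteq> zero_vertices M"
  shows "pair_graph (conflict_graph M S)"
  unfolding conflict_graph_def using assms zero_vertices_not_ones
  by (intro pair_graphI finite_subset[OF assms finite_zero_vertices]) (auto simp: sym_def)

text \<open>
  An edge has two crossing entries, lying in unique rectangles \<open>R\<close> and \<open>R'\<close> of the partition.
  The edges with a given unordered pair \<open>{R, R'}\<close> form a biclique: whether \<open>(x, y')\<close> lies in
  \<open>R = P \<times> Q\<close> and \<open>(x', y)\<close> in \<open>R' = P' \<times> Q'\<close> is a condition on \<open>(x, y)\<close>, namely
  \<open>x \<in> P\<close> and \<open>y \<in> Q'\<close>, and a condition on \<open>(x', y')\<close>, namely \<open>x' \<in> P'\<close> and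
  \<open>y' \<in> Q\<close>. The sides are disjoint because an entry on both would be a zero inside \<open>R\<close>.
\<close>

lemma double_conflict_graph_bicliques:
  "\<exists>\<F>. finite \<F> \<and> card \<F> \<le> (rank_bin M)\<^sup>2 \<and> (\<forall>F\<in>\<F>. biclique (double_conflict_graph M) F) \<and>
    partition_on (parcs (double_conflict_graph M)) \<F>"
proof -
  let ?H = "double_conflict_graph M"
  let ?Z = "zero_vertices M"
  obtain \<R> where \<R>: "finite \<R>" "card \<R> = rank_bin M" "partition_on (ones M) \<R>"
    and rect: "\<And>R. R \<in> \<R> \<Longrightarrow> ones_rectangle M R"
    using rank_bin_partition by metis
  define F where "F = (\<lambda>(R, R'). {(u, v). u \<in> ?Z \<and> v \<in> ?Z \<and>
    ((vertex_row u, vertex_col v) \<in> R \<and> (vertex_row v, vertex_col u) \<in> R' \<or> (vertex_row v, vertex_col u) \<in> R \<and> (vertex_row u, vertex_col v) \<in> R')})"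
  let ?\<F> = "F ` (\<R> \<times> \<R>) - {{}}"
  have sub: "R \<subseteq> ones M" if "R \<in> \<R>" for R
    using \<R>(3) that by (auto simp: partition_on_def)
  have unique: "R = R'" if "R \<in> \<R>" "R' \<in> \<R>" "e \<in> R" "e \<in> R'" for R R' e
    using \<R>(3) that by (auto simp: partition_on_def disjoint_def)
  have F_swap: "F (R', R) = F (R, R')" for R R'
    by (auto simp: F_def)
  have sub_arcs: "F (R, R') \<subseteq> parcs ?H" if "R \<in> \<R>" "R' \<in> \<R>" for R R'
    using sub[OF that(1)] sub[OF that(2)] by (auto simp: F_def double_conflict_graph_def)
  have bic: "biclique ?H (F (R, R'))" if "R \<in> \<R>" "R' \<in> \<R>" for R R'
  proof -
    define A where "A = {v \<in> ?Z. vertex_row v \<in> fst ` R \<and> vertex_col v \<in> snd ` R'}"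
    define B where "B = {v \<in> ?Z. vertex_row v \<in> fst ` R' \<and> vertex_col v \<in> snd ` R}"
    note iff = ones_rectangle_iff[OF rect[OF that(1)]] ones_rectangle_iff[OF rect[OF that(2)]]
    have "v \<notin> B" if "v \<in> A" for v
    proof
      assume "v \<in> B"
      with \<open>v \<in> A\<close> have "(vertex_row v, vertex_col v) \<in> R" "v \<in> ?Z"
        by (simp_all add: A_def B_def iff)
      then show False
        using sub[OF \<open>R \<in> \<R>\<close>] zero_vertices_not_ones by blast
    qed
    then have "A \<inter> B = {}"
      by blast
    moreover have "F (R, R') = A \<times> B \<union> B \<times> A"
    proof -
      have "(u, v) \<in> F (R, R') \<longleftrightarrow> (u, v) \<in> A \<times> B \<union> B \<times> A" for u v
        by (simp add: F_def A_def B_def iff) blast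
      then show ?thesis
        by (simp add: set_eq_iff)
    qed
    moreover have "A \<subseteq> pverts ?H" "B \<subseteq> pverts ?H"
      by (auto simp: A_def B_def double_conflict_graph_def)
    ultimately show ?thesis
      using sub_arcs[OF that] by (intro bicliqueI)
  qed
  have "partition_on (parcs ?H) ?\<F>"
  proof (rule partition_onI)
    show "\<Union> ?\<F> = parcs ?H"
    proof
      show "\<Union> ?\<F> \<subseteq> parcs ?H"
        using sub_arcs by blast
      show "parcs ?H \<subseteq> \<Union> ?\<F>"
      proof
        fix e assume "e \<in> parcs ?H"
        then obtain u v where e: "e = (u, v)" "u \<in> ?Z" "v \<in> ?Z"
          "(vertex_row u, vertex_col v) \<in> ones M" "(vertex_row v, vertex_col u) \<in> ones M"
          by (auto simp: double_conflict_graph_def)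
        obtain R R' where "R \<in> \<R>" "R' \<in> \<R>" "(vertex_row u, vertex_col v) \<in> R" "(vertex_row v, vertex_col u) \<in> R'"
          using e(4,5) \<R>(3) unfolding partition_on_def by blast
        then show "e \<in> \<Union> ?\<F>"
          using e(1,2,3) by (intro UnionI[of "F (R, R')"]) (auto simp: F_def)
      qed
    qed
    fix X Y assume XY: "X \<in> ?\<F>" "Y \<in> ?\<F>" "X \<noteq> Y"
    then obtain R R' T T' where X: "X = F (R, R')" "R \<in> \<R>" "R' \<in> \<R>"
      and Y: "Y = F (T, T')" "T \<in> \<R>" "T' \<in> \<R>"
      by auto
    show "disjnt X Y"
    proof (rule ccontr)
      assume "\<not> disjnt X Y"
      then obtain u v where uv: "(u, v) \<in> F (R, R')" "(u, v) \<in> F (T, T')"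
        using X(1) Y(1) by (auto simp: disjnt_def)
      then have "R = T \<and> R' = T' \<or> R = T' \<and> R' = T"
        using unique X(2,3) Y(2,3) by (auto simp: F_def)
      then show False
        using F_swap X(1) Y(1) XY(3) by auto
    qed
  qed auto
  moreover have "card ?\<F> \<le> (rank_bin M)\<^sup>2"
  proof -
    have "card ?\<F> \<le> card (F ` (\<R> \<times> \<R>))"
      using \<R>(1) by (intro card_mono) auto
    also have "\<dots> \<le> card (\<R> \<times> \<R>)"
      using \<R>(1) by (intro card_image_le) auto
    finally show ?thesis
      by (simp add: card_cartesian_product \<R>(2) power2_eq_square)
  qed
  moreover have "finite ?\<F>"
    using \<R>(1) by auto
  ultimately show ?thesis
    using bic by (intro exI[of _ ?\<F>]) auto
qed

text \<open>
  Without double conflicts each edge has exactly one crossing entry that is a one of \<open>M\<close>, so it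
  belongs to exactly one rectangle of the partition.
\<close>

lemma conflict_graph_bicliques:
  assumes S: "S \<subseteq> zero_vertices M"
    and indep: "\<And>u v. u \<in> S \<Longrightarrow> v \<in> S \<Longrightarrow> (u, v) \<notin> parcs (double_conflict_graph M)"
  shows "\<exists>\<F>. finite \<F> \<and> card \<F> \<le> rank_bin M \<and> (\<forall>F\<in>\<F>. biclique (conflict_graph M S) F) \<and>
    partition_on (parcs (conflict_graph M S)) \<F>"
proof -
  let ?G = "conflict_graph M S"
  obtain \<R> where \<R>: "finite \<R>" "card \<R> = rank_bin M" "partition_on (ones M) \<R>"
    and rect: "\<And>R. R \<in> \<R> \<Longrightarrow> ones_rectangle M R"
    using rank_bin_partition by metis
  define F where "F R = {(u, v). u \<in> S \<and> v \<in> S \<and> ((vertex_row u, vertex_col v) \<in> R \<or> (vertex_row v, vertex_col u) \<in> R)}" for R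
  let ?\<F> = "F ` \<R> - {{}}"
  have sub: "R \<subseteq> ones M" if "R \<in> \<R>" for R
    using \<R>(3) that by (auto simp: partition_on_def)
  have unique: "R = R'" if "R \<in> \<R>" "R' \<in> \<R>" "e \<in> R" "e \<in> R'" for R R' e
    using \<R>(3) that by (auto simp: partition_on_def disjoint_def)
  have not_both: "(vertex_row u, vertex_col v) \<notin> ones M \<or> (vertex_row v, vertex_col u) \<notin> ones M" if "u \<in> S" "v \<in> S" for u v
    using indep[OF that] S that by (auto simp: double_conflict_graph_def)
  have sub_arcs: "F R \<subseteq> parcs ?G" if "R \<in> \<R>" for R
    using sub[OF that] by (auto simp: F_def conflict_graph_def)
  have bic: "biclique ?G (F R)" if "R \<in> \<R>" for R
  proof -
    define A where "A = {v \<in> S. vertex_row v \<in> fst ` R}"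
    define B where "B = {v \<in> S. vertex_col v \<in> snd ` R}"
    note iff = ones_rectangle_iff[OF rect[OF that]]
    have "v \<notin> B" if "v \<in> A" for v
    proof
      assume "v \<in> B"
      with \<open>v \<in> A\<close> have "(vertex_row v, vertex_col v) \<in> R" "v \<in> S"
        by (simp_all add: A_def B_def iff)
      then show False
        using sub[OF \<open>R \<in> \<R>\<close>] zero_vertices_not_ones S by blast
    qed
    then have "A \<inter> B = {}"
      by blast
    moreover have "F R = A \<times> B \<union> B \<times> A"
    proof -
      have "(u, v) \<in> F R \<longleftrightarrow> (u, v) \<in> A \<times> B \<union> B \<times> A" for u v
        by (simp add: F_def A_def B_def iff) blast
      then show ?thesis
        by (simp add: set_eq_iff)
    qed
    moreover have "A \<subseteq> pverts ?G" "B \<subseteq> pverts ?G"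
      by (auto simp: A_def B_def conflict_graph_def)
    ultimately show ?thesis
      using sub_arcs[OF that] by (intro bicliqueI)
  qed
  have "partition_on (parcs ?G) ?\<F>"
  proof (rule partition_onI)
    show "\<Union> ?\<F> = parcs ?G"
    proof
      show "\<Union> ?\<F> \<subseteq> parcs ?G"
        using sub_arcs by blast
      show "parcs ?G \<subseteq> \<Union> ?\<F>"
      proof
        fix e assume "e \<in> parcs ?G"
        then obtain u v where e: "e = (u, v)" "u \<in> S" "v \<in> S"
          "(vertex_row u, vertex_col v) \<in> ones M \<or> (vertex_row v, vertex_col u) \<in> ones M"
          by (auto simp: conflict_graph_def)
        obtain R where "R \<in> \<R>" "(vertex_row u, vertex_col v) \<in> R \<or> (vertex_row v, vertex_col u) \<in> R"
          using e(4) \<R>(3) unfolding partition_on_def by blast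
        then show "e \<in> \<Union> ?\<F>"
          using e(1,2,3) by (intro UnionI[of "F R"]) (auto simp: F_def)
      qed
    qed
    fix X Y assume XY: "X \<in> ?\<F>" "Y \<in> ?\<F>" "X \<noteq> Y"
    then obtain R T where X: "X = F R" "R \<in> \<R>" and Y: "Y = F T" "T \<in> \<R>"
      by auto
    show "disjnt X Y"
    proof (rule ccontr)
      assume "\<not> disjnt X Y"
      then obtain u v where "(u, v) \<in> F R" "(u, v) \<in> F T"
        using X(1) Y(1) by (auto simp: disjnt_def)
      then have uv: "u \<in> S" "v \<in> S" "(vertex_row u, vertex_col v) \<in> R \<or> (vertex_row v, vertex_col u) \<in> R"
        "(vertex_row u, vertex_col v) \<in> T \<or> (vertex_row v, vertex_col u) \<in> T"
        by (auto simp: F_def)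
      have "R = T"
        using uv(3,4) not_both[OF uv(1,2)] unique[OF X(2) Y(2)] sub[OF X(2)] sub[OF Y(2)] by blast
      then show False
        using X(1) Y(1) XY(3) by simp
    qed
  qed auto
  moreover have "card ?\<F> \<le> rank_bin M"
  proof -
    have "card ?\<F> \<le> card (F ` \<R>)"
      using \<R>(1) by (intro card_mono) auto
    also have "\<dots> \<le> card \<R>"
      using \<R>(1) by (intro card_image_le) auto
    finally show ?thesis
      by (simp add: \<R>(2))
  qed
  moreover have "finite ?\<F>"
    using \<R>(1) by auto
  ultimately show ?thesis
    using bic by (intro exI[of _ ?\<F>]) auto
qed

text \<open>
  If no regular graph with few bicliques had a large chromatic number, then, by
  \<open>regular_supergraph\<close>, a number \<open>r\<close> of colours whose square is below the Boolean rank would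
  suffice for the double conflict graph and for the conflict graph on each of its colour classes.
  The pairs of both colours would then give a cover of the zeros by \<open>r\<^sup>2\<close> rectangles.
\<close>

theorem exists_regular_graph_rank_bin_rank_bool:
  fixes M :: "int mat"
  assumes zo: "zero_one_mat M"
  shows "\<exists>G :: nat pair_pre_digraph.
    pair_graph G \<and> pverts G \<noteq> {} \<and> regular_graph G \<and>
    bp G \<le> 10 * (rank_bin M)\<^sup>2 \<and> rank_bool (complement_mat M) \<le> (chromatic_number G)\<^sup>2"
proof (rule ccontr)
  let ?k = "rank_bin M"
  let ?t = "rank_bool (complement_mat M)"
  assume none: "\<not> ?thesis"
  \<comment> \<open>The largest \<open>r\<close> below the square root of the rank serves all the graphs at once.\<close>
  define r where "r = Max {x::nat. x\<^sup>2 < ?t}"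
  have fin: "finite {x::nat. x\<^sup>2 < ?t}"
    by (rule finite_subset[of _ "{..?t}"]) (auto simp: power2_eq_square intro: le_trans[OF le_square])
  have coloring: "{x::nat. x\<^sup>2 < ?t} \<noteq> {} \<and> (\<exists>c. proper_coloring \<Gamma> r c)"
    if \<Gamma>: "pair_graph \<Gamma>" "finite \<F>" "card \<F> \<le> ?k\<^sup>2" "\<forall>F\<in>\<F>. biclique \<Gamma> F" "partition_on (parcs \<Gamma>) \<F>"
    for \<Gamma> :: "nat pair_pre_digraph" and \<F>
  proof -
    obtain G where G: "pair_graph G" "pverts G \<noteq> {}" "regular_graph G"
      "pverts \<Gamma> \<subseteq> pverts G" "parcs \<Gamma> \<subseteq> parcs G" "bp G \<le> 10 * card \<F>"
      using regular_supergraph[OF infinite_UNIV_nat \<Gamma>(1,2) _ \<Gamma>(5)] \<Gamma>(4) by metis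
    have "bp G \<le> 10 * ?k\<^sup>2"
      using G(6) \<Gamma>(3) by linarith
    then have "(chromatic_number G)\<^sup>2 < ?t"
      using none G(1-3) by (meson not_le)
    then have small: "chromatic_number G \<in> {x. x\<^sup>2 < ?t}" and le: "chromatic_number G \<le> r"
      using fin unfolding r_def by auto
    obtain c where "proper_coloring G (chromatic_number G) c"
      using proper_coloring_chromatic_number[OF G(1)] by blast
    then have "proper_coloring \<Gamma> (chromatic_number G) c"
      using G(4,5) by (rule proper_coloring_subgraph)
    then have "proper_coloring \<Gamma> r c"
      using le by (fastforce simp: proper_coloring_def)
    with small show ?thesis
      by blast
  qed
  let ?Z = "zero_vertices M"
  obtain c where nonempty: "{x::nat. x\<^sup>2 < ?t} \<noteq> {}"
    and c: "proper_coloring (double_conflict_graph M) r c"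
    using coloring[OF pair_graph_double_conflict_graph] double_conflict_graph_bicliques[of M] by metis
  define S where "S a = {v \<in> ?Z. c v = a}" for a
  have "\<exists>d. proper_coloring (conflict_graph M (S a)) r d" for a
  proof -
    have "S a \<subseteq> ?Z"
      by (auto simp: S_def)
    moreover have "(u, v) \<notin> parcs (double_conflict_graph M)" if "u \<in> S a" "v \<in> S a" for u v
      using c that by (auto simp: S_def proper_coloring_def)
    ultimately obtain \<F> where "finite \<F>" "card \<F> \<le> ?k" "\<forall>F\<in>\<F>. biclique (conflict_graph M (S a)) F"
      "partition_on (parcs (conflict_graph M (S a))) \<F>"
      using conflict_graph_bicliques by metis
    moreover have "?k \<le> ?k\<^sup>2"
      by (simp add: power2_eq_square)
    ultimately show ?thesis
      using coloring[OF pair_graph_conflict_graph[OF \<open>S a \<subseteq> ?Z\<close>], of \<F>] by (meson le_trans)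
  qed
  then obtain d where d: "\<And>a. proper_coloring (conflict_graph M (S a)) r (d a)"
    by metis
  define f where "f e = (c (prod_encode e), d (c (prod_encode e)) (prod_encode e))" for e
  have "?t \<le> card ({..<r} \<times> {..<r})"
  proof (rule rank_bool_complement_le[OF zo, of _ f])
    show "f ` ones (complement_mat M) \<subseteq> {..<r} \<times> {..<r}"
    proof
      fix p assume "p \<in> f ` ones (complement_mat M)"
      then obtain e where e: "e \<in> ones (complement_mat M)" "p = f e"
        by blast
      then have "prod_encode e \<in> ?Z"
        by (cases e) (simp add: zero_vertices_def)
      then have "c (prod_encode e) < r" "d (c (prod_encode e)) (prod_encode e) < r"
        using c d[of "c (prod_encode e)"]
        by (auto simp: proper_coloring_def double_conflict_graph_def conflict_graph_def S_def)
      then show "p \<in> {..<r} \<times> {..<r}"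
        by (simp add: e(2) f_def)
    qed
    fix x y x' y'
    assume xy: "(x, y) \<in> ones (complement_mat M)" "(x', y') \<in> ones (complement_mat M)"
      and eq: "f (x, y) = f (x', y')"
    let ?u = "prod_encode (x, y)" and ?v = "prod_encode (x', y')"
    have "?u \<in> S (c ?u)" "?v \<in> S (c ?u)"
      using xy eq by (auto simp: S_def zero_vertices_def f_def)
    moreover have "d (c ?u) ?u = d (c ?u) ?v"
      using eq by (auto simp: f_def)
    ultimately have "(?u, ?v) \<notin> parcs (conflict_graph M (S (c ?u)))" "?u \<in> S (c ?u)" "?v \<in> S (c ?u)"
      using d[of "c ?u"] by (auto simp: proper_coloring_def)
    then show "(x, y') \<notin> ones M"
      by (simp add: conflict_graph_def)
  qed simp
  moreover have "r\<^sup>2 < ?t"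
    using Max_in[OF fin nonempty] by (simp add: r_def)
  ultimately show False
    by (simp add: power2_eq_square)
qed

theorem theorem5p1:
  fixes M :: "int mat"
  assumes "square_mat M" and "zero_one_mat M" and "regular_mat M"
  shows "\<exists>G :: nat pair_pre_digraph.
    pair_graph G \<and> pverts G \<noteq> {} \<and> regular_graph G \<and>
    bp G \<le> 33 * (rank_bin M)\<^sup>2 \<and>
    real (chromatic_number G) \<ge> real (rank_bool (complement_mat M)) powr (1 / 3)"
proof -
  let ?t = "rank_bool (complement_mat M)"
  obtain G :: "nat pair_pre_digraph" where G: "pair_graph G" "pverts G \<noteq> {}" "regular_graph G"
    "bp G \<le> 10 * (rank_bin M)\<^sup>2" and t: "?t \<le> (chromatic_number G)\<^sup>2"
    using exists_regular_graph_rank_bin_rank_bool[OF assms(2)] by blast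
  have "real ?t powr (1 / 3) \<le> real (chromatic_number G)"
  proof (cases "chromatic_number G = 0")
    case True
    then show ?thesis using t by simp
  next
    case False
    then have "(chromatic_number G)\<^sup>2 \<le> (chromatic_number G) ^ 3"
      by (intro power_increasing) auto
    then have "?t \<le> (chromatic_number G) ^ 3"
      using t by linarith
    then have "real ?t \<le> real (chromatic_number G) ^ 3"
      by (simp flip: of_nat_power)
    then have "real ?t powr (1 / 3) \<le> (real (chromatic_number G) powr 3) powr (1 / 3)"
      using False by (intro powr_mono2) (auto simp: powr_numeral)
    also have "\<dots> = real (chromatic_number G)"
      unfolding powr_powr by simp
    finally show ?thesis .
  qed
  moreover have "bp G \<le> 33 * (rank_bin M)\<^sup>2"
    using G(4) by linarith
  ultimately show ?thesis
    using G(1-3) by blast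
qed

end
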